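(* Let $m\ge2$. If $\{B_i : 1\leq i\leq m\}$ is an $(n,m;c_1,c_2,\dots,c_l;w_1,w_2,\dots,w_l;\lambda_1,\lambda_2,\dots,\lambda_l)$-PEDF, then $\{B_i : 1\leq i\leq m\}$ is an $(n,m,K=(|B_1|,|B_2|,\dots,|B_m|),a,\lambda)$-SWEDF, where $a=\sum_i|B_i|$, $\widetilde{k}=\mathrm{lcm}(w_1,w_2,\dots,w_l)$ and $\lambda=\sum_{1\leq t\leq l}\frac{\lambda_t\widetilde{k}}{w_t}$.
   Context: Let $G$ be an additive Abelian group of order $n$ with identity $0$. For multi-sets $B_1,B_2$ of elements of $G$, $D(B_1,B_2)$ is the multi-set $\{x-y : x\in B_1,\ y\in B_2\}$; $c\boxtimes B$ is the multi-set in which each element of $B$ is repeated $c$ times; unions are multi-set unions. Let $\mathcal{B}=\{B_i : 1\le i\le m\}$ be a family of pairwise disjoint nonempty subsets of $G$ with $k_i=|B_i|$. $\mathcal{B}$ is an $(n,m;c_1,\dots,c_l;w_1,\dots,w_l;\lambda_1,\dots,\lambda_l)$-partitioned external difference family (PEDF) if $w_1,\dots,w_l$ are the distinct sizes of the sets in $\mathcal{B}$, $c_t=|\{i : |B_i|=w_t,\ 1\le i\le m\}|$ for $1\le t\le l$, and for each $1\le t\le l$, $\bigcup_{\{i:|B_i|=w_t\}}\bigcup_{1\le j\le m,\ j\ne i}D(B_i,B_j)=\lambda_t\boxtimes(G\setminus\{0\})$. With $K=(k_1,\dots,k_m)$, $a=\sum_i k_i$, $\widetilde{k}=\mathrm{lcm}(k_1,\dots,k_m)$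 and $\widetilde{B}_i=\frac{\widetilde{k}}{k_i}\boxtimes B_i$, $\mathcal{B}$ is an $(n,m,K,a,\lambda)$-SWEDF (standard weighted external difference family), $\lambda$ a positive integer, if $\bigcup_{1\le i\ne j\le m}D(B_i,\widetilde{B}_j)=\lambda\boxtimes(G\setminus\{0\})$. *)

theory Defs
  imports Complex_Main "HOL-Library.Multiset" "HOL-Library.Disjoint_Sets" "HOL-Library.Cardinality"
begin

text \<open>The ambient group is a type of sort \<open>{finite, ab_group_add}\<close>; its order is \<open>CARD('a)\<close>.\<close>

definition diff_mset :: "'a::ab_group_add multiset \<Rightarrow> 'a multiset \<Rightarrow> 'a multiset" where
  "diff_mset A B = (\<Sum>x\<in>#A. {#x - y. y \<in># B#})"

definition nonzero_mset :: "'a::{finite,ab_group_add} multiset" where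
  "nonzero_mset = mset_set (UNIV - {0})"

text \<open>Families \<open>B\<^sub>1, \<dots>, B\<^sub>m\<close> are functions on \<open>nat\<close>, of which only the values on \<open>{1..m}\<close> matter;
  the same convention applies to the parameter tuples below.\<close>

definition disjoint_blocks :: "nat \<Rightarrow> (nat \<Rightarrow> 'a set) \<Rightarrow> bool" where
  "disjoint_blocks m B \<longleftrightarrow> disjoint_family_on B {1..m} \<and> (\<forall>i\<in>{1..m}. B i \<noteq> {})"

definition is_PEDF ::
  "nat \<Rightarrow> nat \<Rightarrow> nat \<Rightarrow> (nat \<Rightarrow> nat) \<Rightarrow> (nat \<Rightarrow> nat) \<Rightarrow> (nat \<Rightarrow> nat)
     \<Rightarrow> (nat \<Rightarrow> 'a::{finite,ab_group_add} set) \<Rightarrow> bool" where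
  "is_PEDF n m l c w lam B \<longleftrightarrow>
     CARD('a) = n \<and>
     disjoint_blocks m B \<and>
     inj_on w {1..l} \<and>
     w ` {1..l} = (\<lambda>i. card (B i)) ` {1..m} \<and>
     (\<forall>t\<in>{1..l}. c t = card {i \<in> {1..m}. card (B i) = w t}) \<and>
     (\<forall>t\<in>{1..l}.
        (\<Sum>i\<in>{i \<in> {1..m}. card (B i) = w t}. \<Sum>j\<in>{1..m} - {i}.
           diff_mset (mset_set (B i)) (mset_set (B j)))
        = repeat_mset (lam t) nonzero_mset)"

text \<open>The quotient \<open>Lcm (K ` {1..m}) div K j\<close> is exact.\<close>

definition is_SWEDF ::
  "nat \<Rightarrow> nat \<Rightarrow> (nat \<Rightarrow> nat) \<Rightarrow> nat \<Rightarrow> nat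
     \<Rightarrow> (nat \<Rightarrow> 'a::{finite,ab_group_add} set) \<Rightarrow> bool" where
  "is_SWEDF n m K a lambda B \<longleftrightarrow>
     CARD('a) = n \<and>
     disjoint_blocks m B \<and>
     (\<forall>i\<in>{1..m}. K i = card (B i)) \<and>
     a = (\<Sum>i\<in>{1..m}. K i) \<and>
     lambda > 0 \<and>
     (\<Sum>i\<in>{1..m}. \<Sum>j\<in>{1..m} - {i}.
        diff_mset (mset_set (B i))
          (repeat_mset (Lcm (K ` {1..m}) div K j) (mset_set (B j))))
     = repeat_mset lambda nonzero_mset"

end

theory Submission imports Defs begin

text \<open>Let \<open>L\<close> be the lcm of the block sizes. Grouping the weighted differences
  \<open>D(B\<^sub>i, (L/k\<^sub>j) \<boxtimes> B\<^sub>j)\<close> by the second index \<open>j\<close>, and the indices \<open>j\<close> by the block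
  size \<open>w\<^sub>t\<close>, turns the SWEDF union into the PEDF unions scaled by \<open>L/w\<^sub>t\<close>, except that all
  differences are negated; negation is harmless since it permutes the nonzero group elements.\<close>

lemma diff_mset_empty_left [simp]: "diff_mset {#} C = {#}"
  by (simp add: diff_mset_def)

lemma diff_mset_empty_right [simp]: "diff_mset A {#} = {#}"
  by (simp add: diff_mset_def)

lemma diff_mset_add_left [simp]:
  "diff_mset (add_mset x A) C = {#x - y. y \<in># C#} + diff_mset A C"
  by (simp add: diff_mset_def)

lemma diff_mset_union_right: "diff_mset A (C + D) = diff_mset A C + diff_mset A D"
  by (simp add: diff_mset_def sum_mset.distrib)

lemma diff_mset_add_right [simp]:
  "diff_mset A (add_mset y C) = {#x - y. x \<in># A#} + diff_mset A C"
  by (induction A) simp_all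

lemma diff_mset_repeat_right: "diff_mset A (repeat_mset k C) = repeat_mset k (diff_mset A C)"
  by (induction k) (simp_all add: diff_mset_union_right)

lemma diff_mset_swap: "diff_mset C A = image_mset uminus (diff_mset A C)"
  by (induction A) (simp_all add: multiset.map_comp comp_def)

text \<open>Since \<open>x - y = - (y - x)\<close>, exchanging the two arguments only moves the
  multiplicity of \<open>g\<close> to \<open>- g\<close>.\<close>

lemma count_diff_mset_swap:
  fixes A C :: "'a::ab_group_add multiset"
  shows "count (diff_mset C A) g = count (diff_mset A C) (- g)"
proof -
  have "count (image_mset uminus M) g = count M (- g)" for M :: "'a multiset"
    by (induction M) auto
  then show ?thesis
    by (simp add: diff_mset_swap [of C A])
qed

lemma diff_mset_eq_empty_iff [simp]: "diff_mset A C = {#} \<longleftrightarrow> A = {#} \<or> C = {#}"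
  by (cases A) auto

lemma count_nonzero_mset: "count nonzero_mset g = (if g = 0 then 0 else 1)"
  by (simp add: nonzero_mset_def count_mset_set')

theorem lemma6:
  fixes B :: "nat \<Rightarrow> 'a::{finite,ab_group_add} set"
    and n m l :: nat
    and c w lam :: "nat \<Rightarrow> nat"
  assumes "m \<ge> 2"
    and "is_PEDF n m l c w lam B"
  shows "\<exists>lambda::nat.
    real lambda = (\<Sum>t\<in>{1..l}. real (lam t) * real (Lcm (w ` {1..l})) / real (w t)) \<and>
    is_SWEDF n m (\<lambda>i. card (B i)) (\<Sum>i\<in>{1..m}. card (B i)) lambda B"
proof -
  define k where "k i = card (B i)" for i
  define L where "L = Lcm (w ` {1..l})"
  define I where "I t = {i \<in> {1..m}. k i = w t}" for t
  \<comment> \<open>Comparing multiplicities of a fixed \<open>g\<close> turns the multiset unions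
    into double sums of naturals, which can be reordered.\<close>
  define N where "N i j g = count (diff_mset (mset_set (B i)) (mset_set (B j))) g" for i j g
  define lambda where "lambda = (\<Sum>t\<in>{1..l}. (L div w t) * lam t)"
  have card_n: "CARD('a) = n" and disj: "disjoint_blocks m B" and inj: "inj_on w {1..l}"
    and sizes: "w ` {1..l} = k ` {1..m}"
    using assms(2) unfolding is_PEDF_def k_def by blast+
  have pedf: "(\<Sum>i\<in>I t. \<Sum>j\<in>{1..m} - {i}. diff_mset (mset_set (B i)) (mset_set (B j)))
        = repeat_mset (lam t) nonzero_mset" if "t \<in> {1..l}" for t
    using assms(2) that unfolding is_PEDF_def I_def k_def by blast
  have nonempty: "B i \<noteq> {}" if "i \<in> {1..m}" for i
    using disj that by (simp add: disjoint_blocks_def)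
  have k_pos: "k i > 0" if "i \<in> {1..m}" for i
    using nonempty [OF that] by (simp add: k_def card_gt_0_iff)
  have w_pos: "w t > 0" if "t \<in> {1..l}" for t
    using sizes that k_pos by (metis imageE imageI)
  have w_dvd: "w t dvd L" if "t \<in> {1..l}" for t
    using that by (simp add: L_def)
  have "0 \<notin> w ` {1..l}"
    using w_pos by force
  then have L_pos: "L > 0"
    by (simp add: L_def Lcm_0_iff zero_less_iff_neq_zero)
  have class_count: "(\<Sum>i\<in>I t. \<Sum>j\<in>{1..m} - {i}. N i j g) = lam t * count nonzero_mset g"
    if "t \<in> {1..l}" for t g
    using arg_cong [OF pedf [OF that], of "\<lambda>M. count M g"] by (simp add: N_def count_sum)
  \<comment> \<open>Injectivity of \<open>w\<close> keeps any size from being counted twice, and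
    \<open>sizes\<close> ensures that every block falls into some class \<open>I t\<close>.\<close>
  have partition: "(\<Sum>t\<in>{1..l}. \<Sum>i\<in>I t. f i) = (\<Sum>i\<in>{1..m}. f i)" for f :: "nat \<Rightarrow> nat"
  proof -
    have "(\<Sum>t\<in>{1..l}. \<Sum>i\<in>I t. f i) = (\<Sum>s\<in>w ` {1..l}. \<Sum>i\<in>{i \<in> {1..m}. k i = s}. f i)"
      unfolding sum.reindex [OF inj] I_def comp_def ..
    also have "\<dots> = (\<Sum>i\<in>{1..m}. f i)"
      unfolding sizes by (rule sum.group) simp_all
    finally show ?thesis .
  qed
  have "(\<Sum>i\<in>{1..m}. \<Sum>j\<in>{1..m} - {i}.
      diff_mset (mset_set (B i)) (repeat_mset (L div k j) (mset_set (B j))))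
    = repeat_mset lambda nonzero_mset"
  proof (rule multiset_eqI)
    fix g :: 'a
    \<comment> \<open>The condition \<open>i \<noteq> j\<close> is symmetric, so in this form the
      two sums can be exchanged.\<close>
    have "(\<Sum>i\<in>{1..m}. \<Sum>j\<in>{1..m} - {i}. (L div k j) * N i j g)
      = (\<Sum>i\<in>{1..m}. \<Sum>j\<in>{j \<in> {1..m}. i \<noteq> j}. (L div k j) * N i j g)"
      by (intro sum.cong) auto
    also have "\<dots> = (\<Sum>j\<in>{1..m}. \<Sum>i\<in>{i \<in> {1..m}. i \<noteq> j}. (L div k j) * N i j g)"
      by (rule sum.swap_restrict) simp_all
    \<comment> \<open>The weight depends only on the index that is now outer, so it factors out;
      reversing the differences replaces \<open>g\<close> by \<open>- g\<close>.\<close>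
    also have "\<dots> = (\<Sum>j\<in>{1..m}. (L div k j) * (\<Sum>i\<in>{1..m} - {j}. N j i (- g)))"
      unfolding sum_distrib_left
      by (intro sum.cong arg_cong2 [where f = "(*)"]) (auto simp: N_def intro: count_diff_mset_swap)
    also have "\<dots> = (\<Sum>t\<in>{1..l}. \<Sum>j\<in>I t. (L div k j) * (\<Sum>i\<in>{1..m} - {j}. N j i (- g)))"
      by (rule partition [symmetric])
    also have "\<dots> = (\<Sum>t\<in>{1..l}. (L div w t) * (\<Sum>j\<in>I t. \<Sum>i\<in>{1..m} - {j}. N j i (- g)))"
      unfolding sum_distrib_left [of _ _ "I _"] by (intro sum.cong) (auto simp: I_def)
    \<comment> \<open>The PEDF condition is applied at \<open>- g\<close>, which is zero exactly
      when \<open>g\<close> is.\<close>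
    also have "\<dots> = lambda * count nonzero_mset g"
      unfolding lambda_def sum_distrib_right mult.assoc
      by (intro sum.cong refl) (simp only: class_count count_nonzero_mset neg_equal_0_iff_equal)
    finally show "count (\<Sum>i\<in>{1..m}. \<Sum>j\<in>{1..m} - {i}.
        diff_mset (mset_set (B i)) (repeat_mset (L div k j) (mset_set (B j)))) g
      = count (repeat_mset lambda nonzero_mset) g"
      by (simp add: count_sum diff_mset_repeat_right N_def)
  qed
  \<comment> \<open>As \<open>m \<ge> 2\<close>, blocks 1 and 2 yield some difference
    \<open>g\<close>. It occurs in the PEDF union for the size class of block 1, so the
    \<open>lam t\<close> of that class is positive.\<close>
  moreover have "lambda > 0"
  proof -
    have one: "1 \<in> {1..m}" and two: "2 \<in> {1..m} - {1}"
      using \<open>m \<ge> 2\<close> by auto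
    obtain t where t: "t \<in> {1..l}" "1 \<in> I t"
    proof -
      have "k 1 \<in> w ` {1..l}"
        unfolding sizes using one by (rule imageI)
      then show ?thesis
        using that one unfolding I_def by blast
    qed
    have "diff_mset (mset_set (B 1)) (mset_set (B 2)) \<noteq> {#}"
      using nonempty one two by (simp add: mset_set_empty_iff)
    then obtain g where "g \<in># diff_mset (mset_set (B 1)) (mset_set (B 2))"
      by (rule multiset_nonemptyE)
    then have g: "N 1 2 g > 0"
      by (simp add: N_def)
    have "finite (I t)"
      by (simp add: I_def)
    then have "N 1 2 g \<le> (\<Sum>j\<in>{1..m} - {1}. N 1 j g)"
      using two by (intro member_le_sum) simp_all
    also have "\<dots> \<le> (\<Sum>i\<in>I t. \<Sum>j\<in>{1..m} - {i}. N i j g)"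
      using t(2) \<open>finite (I t)\<close>
      by (intro member_le_sum [of 1 "I t" "\<lambda>i. \<Sum>j\<in>{1..m} - {i}. N i j g"]) simp_all
    also have "\<dots> = lam t * count nonzero_mset g"
      by (rule class_count [OF t(1)])
    finally have "lam t > 0"
      using g by (cases "lam t") simp_all
    moreover have "L div w t > 0"
      using w_dvd [OF t(1)] w_pos [OF t(1)] L_pos by (simp add: div_greater_zero_iff dvd_imp_le)
    ultimately show ?thesis
      unfolding lambda_def using t(1) by (intro sum_pos2 [of _ t]) simp_all
  qed
  \<comment> \<open>Each \<open>w t\<close> divides \<open>L\<close>, so the natural quotients in
    \<open>lambda\<close> agree with the real ones.\<close>
  moreover have "real lambda = (\<Sum>t\<in>{1..l}. real (lam t) * real L / real (w t))"
    unfolding lambda_def of_nat_sum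
    by (intro sum.cong) (simp_all add: real_of_nat_div w_dvd)
  \<comment> \<open>By \<open>sizes\<close>, the lcm over the distinct sizes \<open>w t\<close> is
    the lcm over all block sizes used by \<open>is_SWEDF\<close>.\<close>
  ultimately show ?thesis
    using card_n disj sizes unfolding is_SWEDF_def L_def k_def
    by (intro exI [of _ lambda]) simp
qed

end
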